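(* Let $p\ge 7$ be a prime, and let $A_{p-1}=\sum_{k=0}^{p-1}\binom{p-1}{k}^2\binom{p-1+k}{k}^2$. Then $$A_{p-1}\equiv 1+p^3\left(\frac{4}{3}B_{p-3}-\frac{1}{2}B_{2p-4}\right)+\frac{1}{9}p^4B_{p-3}\pmod{p^5}.$$
   Context: The Bernoulli numbers $B_n$ are defined by $\frac{x}{e^x-1}=\sum_{n=0}^{\infty}B_n\frac{x^n}{n!}$. For rational numbers $a,b$ whose denominators are prime to $p$, $a\equiv b\pmod{p^m}$ means that $a-b$ equals $p^m$ times a rational number with denominator prime to $p$. *)

theory Defs
  imports Complex_Main "HOL-Computational_Algebra.Primes"
begin

text \<open>Bernoulli numbers defined by x/(e^x-1) = sum B_n x^n/n!, i.e. B_0 = 1 and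
  for n \<ge> 1: sum_{k=0}^{n} (n+1 choose k) B_k = 0 (so B_1 = -1/2).\<close>
function bernoulli :: "nat \<Rightarrow> rat" where
  "bernoulli n = (if n = 0 then 1
     else - (\<Sum>k\<in>{..<n}. of_nat ((n + 1) choose k) * bernoulli k) / of_nat (n + 1))"
  by auto
termination by (relation "measure id") auto

declare bernoulli.simps [simp del]

definition p_integral :: "nat \<Rightarrow> rat \<Rightarrow> bool" where
  "p_integral p q \<longleftrightarrow> coprime (snd (quotient_of q)) (int p)"

definition rat_cong_pow :: "rat \<Rightarrow> rat \<Rightarrow> nat \<Rightarrow> nat \<Rightarrow> bool" where
  "rat_cong_pow a b p m \<longleftrightarrow> (\<exists>c. p_integral p c \<and> a - b = of_nat (p ^ m) * c)"

end

theory Submission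
  imports Defs "HOL-Number_Theory.Residues"
begin

text \<open>
  Since \<open>binom(p-1,k) binom(p-1+k,k) = (-1)^k p/(p+k) \<Prod>j\<le>k. (1 - p^2/j^2)\<close>, expanding in
  \<open>p\<close> reduces the sum modulo \<open>p^5\<close> to \<open>1 + p^2 S(-2)\<close>, where \<open>S(e) = \<Sum>k<p. k^e\<close> over \<open>k > 0\<close>.
  Replacing \<open>k\<close> by \<open>2k mod p\<close> gives, for even \<open>e = -2 + t(p-1)\<close>,
  \<open>(2^e - 1) S(e)/(e p) \<equiv> \<Sum>k>p/2. (2k)^(e-1)\<close> modulo \<open>p^2\<close>. By Fermat's little theorem \<open>2^e\<close> and the
  right-hand side have second difference 0 modulo \<open>p^2\<close> as functions of \<open>t\<close>, hence so has \<open>S(e)/(e p)\<close>.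
  This expresses \<open>S(-2)\<close> modulo \<open>p^3\<close> by \<open>S(p-3)\<close> and \<open>S(2p-4)\<close>, and Faulhaber's formula gives
  \<open>S(m) \<equiv> p B_m\<close> modulo \<open>p^3\<close> for these two exponents.
\<close>

section \<open>The ring of p-integral rationals\<close>

locale p_local =
  fixes p :: nat
  assumes prime_p: "prime p"
begin

abbreviation integral :: "rat \<Rightarrow> bool" where
  "integral \<equiv> p_integral p"

definition unit :: "rat \<Rightarrow> bool" where
  "unit q \<longleftrightarrow> (\<exists>a b. \<not> int p dvd a \<and> \<not> int p dvd b \<and> q = of_int a / of_int b)"

text \<open>Membership in the ideal generated by \<open>p ^ m\<close> in the localization at
  \<open>p\<close>: the p-adic valuation of \<open>x\<close> is at least \<open>m\<close>.\<close>

definition pdvd :: "nat \<Rightarrow> rat \<Rightarrow> bool" where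
  "pdvd m x \<longleftrightarrow> (\<exists>c. integral c \<and> x = of_nat p ^ m * c)"

lemma p_nonzero [simp]: "p \<noteq> 0"
  using prime_p by auto

lemma prime_int_p: "prime (int p)"
  using prime_p by simp

lemma not_dvd_mult: "\<not> int p dvd a \<Longrightarrow> \<not> int p dvd b \<Longrightarrow> \<not> int p dvd a * b"
  using prime_int_p prime_dvd_mult_iff by blast

lemma not_dvd_nonzero: "\<not> int p dvd a \<Longrightarrow> a \<noteq> 0"
  by auto

text \<open>The reduced denominator divides every denominator of \<open>q\<close>, so an unreduced
  fraction serves as well. This makes closure under ring operations a matter of common
  denominators.\<close>

lemma integral_iff: "integral q \<longleftrightarrow> (\<exists>a b. \<not> int p dvd b \<and> q = of_int a / of_int b)"
proof
  assume q: "integral q"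
  obtain a b where ab: "quotient_of q = (a, b)" by fastforce
  have "coprime b (int p)" using q ab by (simp add: p_integral_def)
  hence "\<not> int p dvd b"
    using prime_int_p by (metis coprime_absorb_right coprime_commute not_prime_unit)
  moreover have "q = of_int a / of_int b" using quotient_of_div[OF ab] .
  ultimately show "\<exists>a b. \<not> int p dvd b \<and> q = of_int a / of_int b" by blast
next
  assume "\<exists>a b. \<not> int p dvd b \<and> q = of_int a / of_int b"
  then obtain a b where b: "\<not> int p dvd b" and q: "q = of_int a / of_int b" by blast
  obtain c d where cd: "quotient_of q = (c, d)" by fastforce
  have d0: "d > 0" using quotient_of_denom_pos[OF cd] .
  have "of_int c / of_int d = (of_int a / of_int b :: rat)"
    using quotient_of_div[OF cd] q by simp
  hence "of_int (c * b) = (of_int (a * d) :: rat)"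
    using d0 not_dvd_nonzero[OF b] by (simp add: field_simps)
  hence "c * b = a * d" using of_int_eq_iff by blast
  hence "d dvd c * b" by simp
  hence "d dvd b"
    using quotient_of_coprime[OF cd] by (simp add: coprime_commute coprime_dvd_mult_right_iff)
  hence "\<not> int p dvd d" using b dvd_trans by blast
  hence "coprime (int p) d" using prime_imp_coprime[OF prime_int_p] by blast
  thus "integral q" using cd by (simp add: p_integral_def coprime_commute)
qed

lemma integral_of_int [simp]: "integral (of_int a)"
  unfolding integral_iff
  by (rule exI[of _ a], rule exI[of _ 1]) (use prime_int_p not_prime_unit in auto)

lemma integral_of_nat [simp]: "integral (of_nat a)"
  using integral_of_int[of "int a"] by simp

lemma integral_numeral [simp]: "integral (numeral a)"
  using integral_of_nat[of "numeral a"] by simp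

lemma integral_0 [simp]: "integral 0" and integral_1 [simp]: "integral 1"
  using integral_of_nat[of 0] integral_of_nat[of 1] by simp_all

lemma integral_add [intro]:
  assumes "integral x" "integral y"
  shows "integral (x + y)"
proof -
  obtain a b where ab: "\<not> int p dvd b" "x = of_int a / of_int b" using assms integral_iff by blast
  obtain c d where cd: "\<not> int p dvd d" "y = of_int c / of_int d" using assms integral_iff by blast
  have "x + y = of_int (a * d + c * b) / of_int (b * d)"
    using ab cd not_dvd_nonzero by (simp add: field_simps)
  thus ?thesis using not_dvd_mult[OF ab(1) cd(1)] integral_iff by blast
qed

lemma integral_mult [intro]:
  assumes "integral x" "integral y"
  shows "integral (x * y)"
proof -
  obtain a b where ab: "\<not> int p dvd b" "x = of_int a / of_int b" using assms integral_iff by blast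
  obtain c d where cd: "\<not> int p dvd d" "y = of_int c / of_int d" using assms integral_iff by blast
  have "x * y = of_int (a * c) / of_int (b * d)" using ab cd by simp
  thus ?thesis using not_dvd_mult[OF ab(1) cd(1)] integral_iff by blast
qed

lemma integral_minus [intro]: "integral x \<Longrightarrow> integral (- x)"
  using integral_mult[OF integral_of_int[of "-1"]] by simp

lemma integral_diff [intro]: "integral x \<Longrightarrow> integral y \<Longrightarrow> integral (x - y)"
  unfolding diff_conv_add_uminus by (intro integral_add integral_minus)

lemma integral_power [intro]: "integral x \<Longrightarrow> integral (x ^ n)"
  by (induction n) auto

section \<open>Units of the local ring\<close>

lemma unit_integral: "unit x \<Longrightarrow> integral x"
  unfolding unit_def integral_iff by blast

lemma unit_nonzero: "unit x \<Longrightarrow> x \<noteq> 0"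
  unfolding unit_def using not_dvd_nonzero by force

lemma unit_mult [intro]:
  assumes "unit x" "unit y"
  shows "unit (x * y)"
proof -
  obtain a b where ab: "\<not> int p dvd a" "\<not> int p dvd b" "x = of_int a / of_int b"
    using assms unit_def by blast
  obtain c d where cd: "\<not> int p dvd c" "\<not> int p dvd d" "y = of_int c / of_int d"
    using assms unit_def by blast
  have "x * y = of_int (a * c) / of_int (b * d)" using ab cd by simp
  thus ?thesis unfolding unit_def using not_dvd_mult[OF ab(1) cd(1)] not_dvd_mult[OF ab(2) cd(2)] by blast
qed

lemma unit_inverse [intro]:
  assumes "unit x"
  shows "unit (inverse x)"
proof -
  obtain a b where ab: "\<not> int p dvd a" "\<not> int p dvd b" "x = of_int a / of_int b"
    using assms unit_def by blast
  hence "inverse x = of_int b / of_int a" by (simp add: field_simps)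
  thus ?thesis unfolding unit_def using ab by blast
qed

lemma unit_of_int: "\<not> int p dvd a \<Longrightarrow> unit (of_int a)"
  unfolding unit_def
  by (rule exI[of _ a], rule exI[of _ 1]) (use prime_int_p not_prime_unit in auto)

lemma unit_of_nat: "\<not> p dvd a \<Longrightarrow> unit (of_nat a)"
  using unit_of_int[of "int a"] by simp

lemma unit_1 [simp]: "unit 1"
  using unit_of_nat[of 1] prime_p not_prime_unit by auto

lemma unit_minus [intro]: "unit x \<Longrightarrow> unit (- x)"
  using unit_mult[OF unit_of_int[of "-1"], of x] prime_int_p not_prime_unit by auto

lemma unit_divide [intro]: "unit x \<Longrightarrow> unit y \<Longrightarrow> unit (x / y)"
  unfolding divide_inverse by auto

lemma unit_power_int [intro]:
  assumes "unit x"
  shows "unit (x powi e)"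
proof -
  have "unit (y ^ n)" if "unit y" for y and n :: nat
    by (induction n) (use that in auto)
  thus ?thesis using assms unfolding power_int_def by auto
qed

lemma integral_divide_unit [intro]: "integral x \<Longrightarrow> unit y \<Longrightarrow> integral (x / y)"
  unfolding divide_inverse using unit_integral by blast

section \<open>Ideals generated by powers of \<open>p\<close>\<close>

lemma pdvd_0_iff [simp]: "pdvd 0 x \<longleftrightarrow> integral x"
  by (simp add: pdvd_def)

lemma pdvd_zero [simp]: "pdvd m 0"
  unfolding pdvd_def by (rule exI[of _ 0]) simp

lemma pdvd_p_power [simp]: "pdvd m (of_nat p ^ m)"
  unfolding pdvd_def by (rule exI[of _ 1]) simp

lemma pdvd_p [simp]: "pdvd 1 (of_nat p)"
  using pdvd_p_power[of 1] by simp

lemma pdvd_p_Suc [simp]: "pdvd (Suc 0) (of_nat p)"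
  using pdvd_p by simp

lemma pdvd_add [intro]: "pdvd m x \<Longrightarrow> pdvd m y \<Longrightarrow> pdvd m (x + y)"
  unfolding pdvd_def by (elim exE conjE, intro exI conjI, rule integral_add) (auto simp: distrib_left)

lemma pdvd_minus [intro]: "pdvd m x \<Longrightarrow> pdvd m (- x)"
  unfolding pdvd_def by (elim exE conjE, intro exI conjI, rule integral_minus) auto

lemma pdvd_diff [intro]: "pdvd m x \<Longrightarrow> pdvd m y \<Longrightarrow> pdvd m (x - y)"
  unfolding diff_conv_add_uminus by (intro pdvd_add pdvd_minus)

lemma pdvd_sum [intro]: "(\<And>i. i \<in> A \<Longrightarrow> pdvd m (f i)) \<Longrightarrow> pdvd m (sum f A)"
  by (induction A rule: infinite_finite_induct) (simp_all add: pdvd_add)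

lemma pdvd_mult:
  assumes "pdvd m x" "pdvd n y"
  shows "pdvd (m + n) (x * y)"
proof -
  obtain c d where cd: "integral c" "integral d" and "x = of_nat p ^ m * c" "y = of_nat p ^ n * d"
    using assms pdvd_def by blast
  hence "x * y = of_nat p ^ (m + n) * (c * d)" by (simp add: power_add)
  thus ?thesis unfolding pdvd_def using integral_mult[OF cd] by blast
qed

lemma pdvd_mult_left: "integral x \<Longrightarrow> pdvd m y \<Longrightarrow> pdvd m (x * y)"
  using pdvd_mult[of 0 x m y] by simp

lemma pdvd_mult_right: "pdvd m x \<Longrightarrow> integral y \<Longrightarrow> pdvd m (x * y)"
  using pdvd_mult_left[of y m x] by (simp add: mult.commute)

lemma pdvd_mono:
  assumes "pdvd n x" "m \<le> n"
  shows "pdvd m x"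
proof -
  obtain c where c: "integral c" "x = of_nat p ^ n * c" using assms pdvd_def by blast
  have "of_nat p ^ n = (of_nat p ^ m * of_nat p ^ (n - m) :: rat)"
    using assms(2) by (simp flip: power_add)
  hence "x = of_nat p ^ m * (of_nat p ^ (n - m) * c)" using c by simp
  moreover have "integral (of_nat p ^ (n - m) * c)"
    by (intro integral_mult integral_power integral_of_nat c)
  ultimately show ?thesis unfolding pdvd_def by blast
qed

lemma pdvd_integral: "pdvd m x \<Longrightarrow> integral x"
  using pdvd_mono[of m x 0] by simp

lemma pdvd_mult_p_iff: "pdvd (Suc m) (of_nat p * x) \<longleftrightarrow> pdvd m x"
  unfolding pdvd_def by (simp add: mult.assoc)

lemma pdvd_unit_cancel: "unit u \<Longrightarrow> pdvd m (u * x) \<Longrightarrow> pdvd m x"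
  using pdvd_mult_left[OF unit_integral[OF unit_inverse], of u m "u * x"] unit_nonzero[of u]
  by (simp add: mult.assoc[symmetric])

lemma pdvd_cong: "pdvd m x \<Longrightarrow> pdvd m (y - x) \<Longrightarrow> pdvd m y"
  using pdvd_add[of m x "y - x"] by simp

text \<open>Over the common denominator \<open>b * d\<close> the numerator of \<open>y\<close> is
  \<open>a * d\<close> plus a multiple of \<open>p\<close>, hence still prime to
  \<open>p\<close>.\<close>

lemma unit_cong:
  assumes "unit x" "pdvd 1 (y - x)"
  shows "unit y"
proof -
  obtain a b where ab: "\<not> int p dvd a" "\<not> int p dvd b" "x = of_int a / of_int b"
    using assms unit_def by blast
  obtain c where c: "integral c" "y - x = of_nat p * c"
    using assms(2) pdvd_def by auto
  obtain r d where rd: "\<not> int p dvd d" "c = of_int r / of_int d"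
    using c(1) integral_iff by blast
  have "y = of_int a / of_int b + of_nat p * (of_int r / of_int d)"
    using c(2) ab(3) rd(2) by (simp add: algebra_simps)
  also have "\<dots> = of_int (a * d + int p * (r * b)) / of_int (b * d)"
    using not_dvd_nonzero[OF ab(2)] not_dvd_nonzero[OF rd(1)] by (simp add: field_simps)
  finally have y: "y = of_int (a * d + int p * (r * b)) / of_int (b * d)" .
  have "\<not> int p dvd a * d + int p * (r * b)"
    using not_dvd_mult[OF ab(1) rd(1)] by (metis dvd_add_left_iff dvd_triv_left)
  thus ?thesis unfolding unit_def using y not_dvd_mult[OF ab(2) rd(1)] by blast
qed

lemma rat_cong_pow_iff: "rat_cong_pow a b p m \<longleftrightarrow> pdvd m (a - b)"
  by (simp add: rat_cong_pow_def pdvd_def)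

lemma fermat_unit:
  assumes "\<not> p dvd k"
  shows "pdvd 1 (of_nat k ^ (p - 1) - 1)"
proof -
  have "[k ^ (p - 1) = 1] (mod p)" using fermat_theorem[OF prime_p assms] .
  hence "[int (k ^ (p - 1)) = int 1] (mod int p)" by (simp only: cong_int_iff)
  hence "int p dvd int (k ^ (p - 1)) - int 1" by (simp add: cong_iff_dvd_diff)
  then obtain r where "int (k ^ (p - 1)) - int 1 = int p * r" by blast
  hence "(of_int (int (k ^ (p - 1)) - int 1) :: rat) = of_int (int p * r)" by simp
  hence "of_nat k ^ (p - 1) - 1 = of_nat p * (of_int r :: rat)" by simp
  thus ?thesis unfolding pdvd_def by auto
qed

text \<open>The binomial series to second order. Since both sides satisfy the same recursion in the
  exponent up to a multiple of \<open>z ^ 3\<close> and \<open>x + z\<close> is invertible, it holds for negative exponents too.\<close>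
lemma power_int_add_expand:
  assumes x: "unit x" and z: "pdvd 1 z" and half: "unit 2"
  shows "pdvd 3 ((x + z) powi e -
    (x powi e + of_int e * z * x powi (e - 1) + of_int (e * (e - 1)) / 2 * z ^ 2 * x powi (e - 2)))"
    (is "pdvd 3 (?G e)")
proof -
  have u: "unit (x + z)" using unit_cong[OF x, of "x + z"] z by simp
  note nz = unit_nonzero[OF x] unit_nonzero[OF u]
  have z3: "pdvd 3 (z ^ 3)"
    using pdvd_mult[OF z pdvd_mult[OF z z]] by (simp add: power3_eq_cube numeral_3_eq_3 mult.assoc)
  have step: "?G (e + 1) = (x + z) * ?G e + of_int (e * (e - 1)) / 2 * x powi (e - 2) * z ^ 3" for e
  proof -
    \<comment> \<open>Writing all powers of \<open>x\<close> through the lowest one,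
      \<open>w\<close>, turns the recursion into a polynomial identity.\<close>
    define w where "w = x powi (e - 2)"
    have "x powi (e - 1) = w * x" "x powi e = w * x ^ 2" "x powi (e + 1) = w * x ^ 3"
      using nz power_int_add[of x "e - 2" 1] power_int_add[of x "e - 2" 2]
        power_int_add[of x "e - 2" 3] by (simp_all add: w_def add.commute)
    moreover have "(x + z) powi (e + 1) = (x + z) powi e * (x + z)"
      using nz by (simp add: power_int_add)
    moreover have "e + 1 - 1 = e" "e + 1 - 2 = e - 1" by simp_all
    moreover have "v * (x + z) - (w * x ^ 3 + (E + 1) * z * (w * x ^ 2) + (E + 1) * E / 2 * z ^ 2 * (w * x))
        = (x + z) * (v - (w * x ^ 2 + E * z * (w * x) + E * (E - 1) / 2 * z ^ 2 * w))
          + E * (E - 1) / 2 * w * z ^ 3" for v E :: rat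
      by (simp add: field_simps power2_eq_square power3_eq_cube)
    ultimately show ?thesis by (simp flip: w_def)
  qed
  have err: "pdvd 3 (of_int (e * (e - 1)) / 2 * x powi (e - 2) * z ^ 3)" for e
    by (rule pdvd_mult_left[OF _ z3]) (intro integral_mult integral_divide_unit integral_of_int half
        unit_integral[OF unit_power_int[OF x]])
  show ?thesis
  proof (induction e rule: int_induct[where k = 0])
    case base
    show ?case by simp
  next
    case (step1 e)
    show ?case unfolding step
      by (intro pdvd_add pdvd_mult_left unit_integral[OF u] step1.IH err)
  next
    case (step2 e)
    \<comment> \<open>Downwards, the recursion at \<open>e - 1\<close> controls only the product
      with \<open>x + z\<close>, which is then cancelled as a unit.\<close>
    have "(x + z) * ?G (e - 1) = ?G e - of_int ((e - 1) * (e - 1 - 1)) / 2 * x powi (e - 1 - 2) * z ^ 3"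
      using step[of "e - 1"] by simp
    hence "pdvd 3 ((x + z) * ?G (e - 1))" using pdvd_diff[OF step2.IH err[of "e - 1"]] by simp
    thus ?case by (rule pdvd_unit_cancel[OF u])
  qed
qed

end

section \<open>Power sums with integer exponents\<close>

locale p_ge_7 = p_local +
  assumes p_ge_7: "p \<ge> 7"
begin

definition h :: nat where "h = (p - 1) div 2"

definition S :: "int \<Rightarrow> rat" where "S e = (\<Sum>k=1..p-1. of_nat k powi e)"

text \<open>The bases are the upper half of the nonzero residues, exactly those whose doubles exceed
  \<open>p\<close>.\<close>

definition T :: "int \<Rightarrow> rat" where "T e = (\<Sum>k=1..h. of_nat (k + h) powi e)"

lemma p_eq: "p = 2 * h + 1"
proof -
  have "odd p" using prime_odd_nat[OF prime_p] p_ge_7 by simp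
  thus ?thesis unfolding h_def by presburger
qed

lemma of_nat_p_eq: "(of_nat p :: rat) = 2 * of_nat h + 1"
  using arg_cong[OF p_eq, of "of_nat :: nat \<Rightarrow> rat"] by simp

lemma unit_less: "0 < k \<Longrightarrow> k < p \<Longrightarrow> unit (of_nat k)"
  using unit_of_nat nat_dvd_not_less by blast

lemma unit_2: "unit 2" and unit_3: "unit 3" and unit_5: "unit 5"
  using unit_less[of 2] unit_less[of 3] unit_less[of 5] p_ge_7 by simp_all

lemmas expand = power_int_add_expand[OF _ _ unit_2]

lemma expand2:
  assumes x: "unit x" and z: "pdvd 1 z"
  shows "pdvd 2 ((x + z) powi e - (x powi e + of_int e * z * x powi (e - 1)))"
proof -
  have "pdvd 2 (of_int (e * (e - 1)) / 2 * x powi (e - 2) * (z * z))"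
  proof (rule pdvd_mult_left)
    show "integral (of_int (e * (e - 1)) / 2 * x powi (e - 2))"
      by (intro integral_mult integral_divide_unit integral_of_int unit_2
          unit_integral[OF unit_power_int[OF x]])
    show "pdvd 2 (z * z)" using pdvd_mult[OF z z] by (simp add: numeral_2_eq_2)
  qed
  from pdvd_add[OF pdvd_mono[OF expand[OF x z, of e], of 2] this] show ?thesis
    by (simp add: power2_eq_square algebra_simps)
qed

lemma expand1:
  assumes x: "unit x" and z: "pdvd 1 z"
  shows "pdvd 1 ((x + z) powi e - x powi e)"
proof -
  have "pdvd 1 (z * (of_int e * x powi (e - 1)))"
    by (intro pdvd_mult_right[OF z] integral_mult integral_of_int
        unit_integral[OF unit_power_int[OF x]])
  from pdvd_add[OF pdvd_mono[OF expand2[OF x z, of e], of 1] this] show ?thesis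
    by (simp add: algebra_simps)
qed

lemma unit_upper: "k \<in> {1..h} \<Longrightarrow> unit (of_nat (k + h))"
  using p_eq by (intro unit_less) auto

section \<open>Doubling and reflection of residues\<close>

lemma sum_split_parity: "(\<Sum>k=1..2*n. f k) = (\<Sum>k=1..n. f (2 * k)) + (\<Sum>k=1..n. f (2 * k - 1))"
  for f :: "nat \<Rightarrow> rat"
  by (induction n) (simp_all add: algebra_simps)

lemma sum_split_halves: "(\<Sum>k=1..2*n. f k) = (\<Sum>k=1..n. f k) + (\<Sum>k=1..n. f (k + n))"
  for f :: "nat \<Rightarrow> rat"
proof -
  have "{1..2*n} = {1..n} \<union> {n+1..2*n}" by auto
  hence "(\<Sum>k=1..2*n. f k) = (\<Sum>k=1..n. f k) + (\<Sum>k=n+1..2*n. f k)"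
    by (simp add: sum.union_disjoint)
  also have "(\<Sum>k=n+1..2*n. f k) = (\<Sum>k=1..n. f (k + n))"
    using sum.shift_bounds_cl_nat_ivl[of f 1 n n] by (simp add: mult_2 add.commute)
  finally show ?thesis .
qed

text \<open>Multiplication by 2 permutes the residues: \<open>2k\<close> for \<open>k \<le> h\<close>, and \<open>2k - p\<close> for \<open>k > h\<close>.\<close>
lemma S_doubling:
  "(1 - 2 powi e) * S e
     = (\<Sum>k=1..h. (2 * of_nat (k + h) + - of_nat p) powi e - (2 * of_nat (k + h)) powi e)"
proof -
  have p1: "p - 1 = 2 * h" using p_eq by simp
  \<comment> \<open>Since \<open>p = 2 * h + 1\<close>, the odd residue \<open>2 * k - 1\<close> is
    \<open>2 * (k + h) - p\<close>.\<close>
  have "(\<Sum>k=1..h. of_nat (2 * k - 1) powi e)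
      = (\<Sum>k=1..h. (2 * of_nat (k + h) + - of_nat p) powi e :: rat)"
    by (intro sum.cong refl) (auto simp: of_nat_p_eq)
  hence "S e = (\<Sum>k=1..h. of_nat (2 * k) powi e)
      + (\<Sum>k=1..h. (2 * of_nat (k + h) + - of_nat p) powi e)"
    unfolding S_def p1 by (subst sum_split_parity) simp
  moreover have "2 powi e * S e
      = (\<Sum>k=1..h. of_nat (2 * k) powi e) + (\<Sum>k=1..h. (2 * of_nat (k + h)) powi e)"
    unfolding S_def p1
    by (subst sum_split_halves)
      (simp only: distrib_left sum_distrib_left power_int_mult_distrib of_nat_mult of_nat_numeral)
  ultimately show ?thesis by (simp add: left_diff_distrib sum_subtractf)
qed

text \<open>Each summand of \<open>S_doubling\<close> is expanded to second order around
  \<open>2 * (k + h)\<close> with increment \<open>-p\<close>; the leading terms cancel.\<close>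

lemma S_doubling_cong:
  "pdvd 3 ((1 - 2 powi e) * S e - (- of_int e * of_nat p * 2 powi (e - 1) * T (e - 1)
     + of_int (e * (e - 1)) / 2 * of_nat p ^ 2 * 2 powi (e - 2) * T (e - 2)))"
proof -
  have "(1 - 2 powi e) * S e - (- of_int e * of_nat p * 2 powi (e - 1) * T (e - 1)
     + of_int (e * (e - 1)) / 2 * of_nat p ^ 2 * 2 powi (e - 2) * T (e - 2))
    = (\<Sum>k=1..h. (2 * of_nat (k + h) + - of_nat p) powi e - ((2 * of_nat (k + h)) powi e
        + of_int e * (- of_nat p) * (2 * of_nat (k + h)) powi (e - 1)
        + of_int (e * (e - 1)) / 2 * (- of_nat p) ^ 2 * (2 * of_nat (k + h)) powi (e - 2)))"
    unfolding S_doubling T_def sum_distrib_left power_int_mult_distrib sum_subtractf[symmetric]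
      sum.distrib[symmetric]
    by (intro sum.cong refl) (simp add: algebra_simps)
  also have "pdvd 3 \<dots>"
    by (intro pdvd_sum expand unit_mult unit_2 unit_upper pdvd_minus pdvd_p)
  finally show ?thesis .
qed

text \<open>Every difference in \<open>S_doubling\<close> vanishes modulo \<open>p\<close>, and the
  factor \<open>1 - 2 powi e\<close> can be cancelled.\<close>

lemma S_pdvd_1:
  assumes "unit (2 powi e - 1)"
  shows "pdvd 1 (S e)"
proof -
  have "unit (1 - 2 powi e)" using unit_minus[OF assms] by simp
  moreover have "pdvd 1 ((1 - 2 powi e) * S e)"
    unfolding S_doubling
    by (intro pdvd_sum expand1 unit_mult unit_2 unit_upper pdvd_minus pdvd_p)
  ultimately show ?thesis using pdvd_unit_cancel by blast
qed

text \<open>For even exponents the reflection of \<open>k\<close> to \<open>p - k\<close> identifies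
  the two half sums modulo \<open>p\<close>, so \<open>S e\<close> is congruent to
  \<open>2 * T e\<close>.\<close>

lemma T_pdvd_1:
  assumes "even e" "pdvd 1 (S e)"
  shows "pdvd 1 (T e)"
proof -
  have p1: "p - 1 = 2 * h" using p_eq by simp
  have "(\<Sum>k=1..h. of_nat k powi e) = (\<Sum>k=1..h. (of_nat (k + h) + - of_nat p) powi e :: rat)"
  \<comment> \<open>The index \<open>h + 1 - k\<close> becomes \<open>p - k\<close> after the shift
    by \<open>h\<close>.\<close>
  proof (rule sum.reindex_bij_witness[of _ "\<lambda>k. h + 1 - k" "\<lambda>k. h + 1 - k"])
    fix k assume k: "k \<in> {1..h}"
    hence "of_nat (h + 1 - k + h) + - of_nat p = (- of_nat k :: rat)"
      by (auto simp: of_nat_p_eq)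
    thus "(of_nat (h + 1 - k + h) + - of_nat p) powi e = (of_nat k powi e :: rat)"
      using assms(1) by simp
  qed auto
  hence "S e - 2 * T e
      = (\<Sum>k=1..h. (of_nat (k + h) + - of_nat p) powi e - of_nat (k + h) powi e)"
    unfolding S_def p1 T_def by (subst sum_split_halves) (simp add: sum_subtractf)
  also have "pdvd 1 \<dots>" by (intro pdvd_sum expand1 unit_upper pdvd_minus pdvd_p)
  finally have "pdvd 1 (2 * T e)" using pdvd_diff[OF assms(2)] by fastforce
  thus ?thesis using pdvd_unit_cancel[OF unit_2] by blast
qed

text \<open>Reflecting \<open>k\<close> to \<open>p - k\<close> changes the sign of an odd power,
  and expanding modulo \<open>p^2\<close> gives \<open>2 * S e\<close> congruent to
  \<open>e * p * S (e - 1)\<close>.\<close>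

lemma S_odd_pdvd_2:
  assumes "odd e" "pdvd 1 (S (e - 1))"
  shows "pdvd 2 (S e)"
proof -
  have "S e = (\<Sum>k=1..p-1. - ((of_nat k + - of_nat p) powi e))"
    unfolding S_def
  proof (rule sum.reindex_bij_witness[of _ "\<lambda>k. p - k" "\<lambda>k. p - k"])
    fix k assume k: "k \<in> {1..p-1}"
    hence "of_nat (p - k) + - of_nat p = (- of_nat k :: rat)" by auto
    thus "- ((of_nat (p - k) + - of_nat p) powi e) = (of_nat k powi e :: rat)"
      using assms(1) by simp
  qed auto
  hence "2 * S e - of_int e * (of_nat p * S (e - 1)) = (\<Sum>k=1..p-1. - ((of_nat k + - of_nat p) powi e
      - (of_nat k powi e + of_int e * (- of_nat p) * of_nat k powi (e - 1))))"
    by (simp add: S_def sum_subtractf sum.distrib sum_distrib_left sum_negf algebra_simps)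
  also have "pdvd 2 \<dots>"
    using p_ge_7 by (intro pdvd_sum pdvd_minus expand2 unit_less pdvd_p) auto
  finally have "pdvd 2 (2 * S e - of_int e * (of_nat p * S (e - 1)))" .
  moreover have "pdvd 2 (of_int e * (of_nat p * S (e - 1)))"
    using assms(2) by (intro pdvd_mult_left[OF integral_of_int])
      (simp add: numeral_2_eq_2 pdvd_mult_p_iff)
  ultimately have "pdvd 2 (2 * S e)" using pdvd_cong by blast
  thus ?thesis using pdvd_unit_cancel[OF unit_2] by blast
qed

section \<open>Fermat's little theorem for integer exponents\<close>

lemma power_int_shift_cong:
  assumes "\<not> p dvd k"
  shows "pdvd 1 (of_nat k powi (e + int t * (int p - 1)) - of_nat k powi e)"
proof -
  have k: "unit (of_nat k)" using unit_of_nat assms by blast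
  have F: "pdvd 1 (of_nat k ^ (p - 1) - 1)"
    by (rule fermat_unit[OF assms])
  show ?thesis
  proof (induction t)
    case (Suc t)
    have "e + int (Suc t) * (int p - 1) = (e + int t * (int p - 1)) + int (p - 1)"
      using p_ge_7 by (simp add: algebra_simps)
    hence "of_nat k powi (e + int (Suc t) * (int p - 1))
        = of_nat k powi (e + int t * (int p - 1)) * (of_nat k ^ (p - 1) :: rat)"
      using unit_nonzero[OF k] power_int_add[of "of_nat k :: rat" _ "int (p - 1)"]
      by (simp only: power_int_of_nat of_nat_eq_0_iff) simp
    hence "of_nat k powi (e + int (Suc t) * (int p - 1)) - of_nat k powi (e + int t * (int p - 1))
        = of_nat k powi (e + int t * (int p - 1)) * (of_nat k ^ (p - 1) - 1 :: rat)"
      by (simp add: right_diff_distrib)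
    also have "pdvd 1 \<dots>" by (intro pdvd_mult_left F unit_integral unit_power_int k)
    finally show ?case using pdvd_add[OF _ Suc.IH] by fastforce
  qed simp
qed

text \<open>The second difference of a geometric progression factors as \<open>k powi e\<close>
  times the square of \<open>k ^ (p - 1) - 1\<close>, and Fermat gives one factor \<open>p\<close>
  for each of the two.\<close>

lemma power_int_second_difference:
  assumes "\<not> p dvd k"
  shows "pdvd 2 (of_nat k powi e - 2 * of_nat k powi (e + (int p - 1)) + of_nat k powi (e + 2 * (int p - 1)))"
proof -
  have k: "unit (of_nat k)" using unit_of_nat assms by blast
  have F: "pdvd 1 (of_nat k ^ (p - 1) - 1)"
    by (rule fermat_unit[OF assms])
  have q: "int p - 1 = int (p - 1)" using p_ge_7 by simp
  have e2: "e + 2 * int (p - 1) = e + int (p - 1) + int (p - 1)" by simp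
  have "of_nat k powi e - 2 * of_nat k powi (e + (int p - 1)) + of_nat k powi (e + 2 * (int p - 1))
     = of_nat k powi e * ((of_nat k ^ (p - 1) - 1) * (of_nat k ^ (p - 1) - 1) :: rat)"
  proof -
    define K :: rat where "K = of_nat k"
    have K: "K \<noteq> 0" using unit_nonzero[OF k] by (simp add: K_def)
    show ?thesis
      unfolding q e2 K_def[symmetric] power_int_add[OF disjI1[OF K]] power_int_of_nat
      by (simp only: algebra_simps mult_2)
  qed
  also have "pdvd 2 \<dots>"
    using pdvd_mult[OF F F] unit_integral[OF unit_power_int[OF k]]
    by (auto intro: pdvd_mult_left simp: numeral_2_eq_2)
  finally show ?thesis .
qed

text \<open>At \<open>t = 0\<close> the values are -3/4 and -15/16, units because \<open>p\<close>
  exceeds 5; Fermat carries this to all \<open>t\<close>.\<close>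

lemma unit_two_powi_minus_1:
  shows "unit (2 powi (-2 + int t * (int p - 1)) - 1)" "unit (2 powi (-4 + int t * (int p - 1)) - 1)"
proof -
  have *: "pdvd 1 ((2 powi (e + int t * (int p - 1)) - 1) - (2 powi e - 1))" for e
    using power_int_shift_cong[of 2 e t] p_ge_7 nat_dvd_not_less[of 2 p] by simp
  have "unit (- 3 / (2 * 2))" "unit (- (3 * 5) / (2 * 2 * 2 * 2))"
    by (intro unit_divide unit_minus unit_mult unit_2 unit_3 unit_5)+
  hence "unit (2 powi -2 - 1)" "unit (2 powi -4 - 1)"
    by (simp_all add: power_int_def power_divide)
  thus "unit (2 powi (-2 + int t * (int p - 1)) - 1)" "unit (2 powi (-4 + int t * (int p - 1)) - 1)"
    using unit_cong * by blast+
qed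

text \<open>The even cases follow from doubling. Since \<open>p - 1\<close> is even, the exponents
  starting at -3 are odd, and reflection reduces them to those starting at -4.\<close>

lemma S_pdvd:
  shows "pdvd 1 (S (-2 + int t * (int p - 1)))"
    and "pdvd 1 (S (-4 + int t * (int p - 1)))"
    and "pdvd 2 (S (-3 + int t * (int p - 1)))"
proof -
  show "pdvd 1 (S (-2 + int t * (int p - 1)))" and s4: "pdvd 1 (S (-4 + int t * (int p - 1)))"
    by (intro S_pdvd_1 unit_two_powi_minus_1)+
  have "-3 + int t * (int p - 1) - 1 = -4 + int t * (int p - 1)" by simp
  moreover have "int p - 1 = 2 * int h" using p_eq by linarith
  hence "odd (-3 + int t * (int p - 1))" by simp
  ultimately show "pdvd 2 (S (-3 + int t * (int p - 1)))" using S_odd_pdvd_2 s4 by metis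
qed

section \<open>A Kummer congruence for power sums\<close>

text \<open>For \<open>t = 0, 1, 2\<close> these are -2, \<open>p - 3\<close> and
  \<open>2 * p - 4\<close>: the exponent wanted and the two Bernoulli indices.\<close>

definition e_t :: "nat \<Rightarrow> int" where "e_t t = -2 + int t * (int p - 1)"

text \<open>The factor \<open>2 powi (e - 1)\<close> is absorbed into the bases, so that differences
  in \<open>e\<close> can be taken term by term.\<close>

definition G :: "int \<Rightarrow> rat" where "G e = (\<Sum>k=1..h. of_nat (2 * (k + h)) powi (e - 1))"

text \<open>The power-sum counterpart of the quotient of \<open>B_n\<close> by \<open>n\<close> in
  Kummer's congruences.\<close>

definition Y :: "nat \<Rightarrow> rat" where "Y t = S (e_t t) / (of_int (e_t t) * of_nat p)"

lemma G_eq: "G e = 2 powi (e - 1) * T (e - 1)"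
  unfolding G_def T_def
  by (simp only: sum_distrib_left power_int_mult_distrib of_nat_mult of_nat_numeral)

lemma not_dvd_double: "k \<in> {1..h} \<Longrightarrow> \<not> p dvd 2 * (k + h)"
  using p_eq p_ge_7 nat_dvd_not_less[of "k + h" p] nat_dvd_not_less[of 2 p]
  unfolding prime_dvd_mult_iff[OF prime_p] by auto

text \<open>The quadratic term of \<open>S_doubling_cong\<close> contains
  \<open>p^2 * T (e - 2)\<close>, and the even exponent \<open>e - 2\<close> supplies a third factor
  \<open>p\<close>.\<close>

lemma S_G_cong: "pdvd 3 ((2 powi e_t t - 1) * S (e_t t) - of_nat p * (of_int (e_t t) * G (e_t t)))"
proof -
  let ?e = "e_t t"
  let ?Z = "of_int (?e * (?e - 1)) / 2 * 2 powi (?e - 2) * (of_nat p * (of_nat p * T (?e - 2))) :: rat"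
  have e4: "?e - 2 = -4 + int t * (int p - 1)" by (simp add: e_t_def)
  have "int p - 1 = 2 * int h" using p_eq by linarith
  hence "even (?e - 2)" unfolding e4 by simp
  hence "pdvd 1 (T (?e - 2))" using S_pdvd(2)[of t] T_pdvd_1 unfolding e4 by blast
  hence "pdvd 3 (of_nat p * (of_nat p * T (?e - 2)))"
    by (simp add: numeral_3_eq_3 pdvd_mult_p_iff)
  moreover have "integral (of_int (?e * (?e - 1)) / 2 * 2 powi (?e - 2))"
    by (intro integral_mult integral_divide_unit integral_of_int unit_2
        unit_integral[OF unit_power_int])
  ultimately have "pdvd 3 ?Z" by (rule pdvd_mult_left[rotated])
  from pdvd_diff[OF pdvd_minus[OF S_doubling_cong[of ?e]] this] show ?thesis
    unfolding G_eq by (simp add: algebra_simps power2_eq_square)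
qed

lemma integral_Y:
  assumes "unit (of_int (e_t t))"
  shows "integral (Y t)"
proof -
  obtain c where "integral c" "S (e_t t) = of_nat p * c"
    using S_pdvd(1)[of t] unfolding e_t_def pdvd_def by auto
  thus ?thesis using assms by (auto simp: Y_def)
qed

lemma Y_G_cong:
  assumes u: "unit (of_int (e_t t))"
  shows "pdvd 2 ((2 powi e_t t - 1) * Y t - G (e_t t))"
proof -
  have "of_nat p * (of_int (e_t t) * ((2 powi e_t t - 1) * Y t - G (e_t t)))
      = (2 powi e_t t - 1) * S (e_t t) - of_nat p * (of_int (e_t t) * G (e_t t))"
    using unit_nonzero[OF u] by (simp add: Y_def field_simps)
  hence "pdvd 3 (of_nat p * (of_int (e_t t) * ((2 powi e_t t - 1) * Y t - G (e_t t))))"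
    using S_G_cong[of t] by simp
  hence "pdvd 2 (of_int (e_t t) * ((2 powi e_t t - 1) * Y t - G (e_t t)))"
    using pdvd_mult_p_iff[of 2] by (simp add: numeral_3_eq_3 numeral_2_eq_2)
  thus ?thesis by (rule pdvd_unit_cancel[OF u])
qed

text \<open>Discrete product rule: the second difference of \<open>c * y\<close> is
  \<open>c1\<close> times that of \<open>y\<close>, plus \<open>y1\<close> times that of
  \<open>c\<close>, plus products of first differences, each divisible by
  \<open>p^2\<close>.\<close>

lemma second_difference_cancel:
  assumes u: "unit c1" and Y: "integral y0" "integral y1" "integral y2"
    and eq: "pdvd 2 (c0 * y0 - g0)" "pdvd 2 (c1 * y1 - g1)" "pdvd 2 (c2 * y2 - g2)"
    and c: "pdvd 1 (c1 - c0)" "pdvd 1 (c2 - c1)" "pdvd 2 (c0 - 2 * c1 + c2)"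
    and g: "pdvd 1 (g1 - g0)" "pdvd 1 (g2 - g1)" "pdvd 2 (g0 - 2 * g1 + g2)"
  shows "pdvd 1 (y2 - y1)" "pdvd 2 (y0 - 2 * y1 + y2)"
proof -
  have eq1: "pdvd 1 (c0 * y0 - g0)" "pdvd 1 (c1 * y1 - g1)" "pdvd 1 (c2 * y2 - g2)"
    using eq pdvd_mono[of 2 _ 1] by simp_all
  have "pdvd 1 ((c1 * y1 - g1) - (c0 * y0 - g0) + (g1 - g0) - (c1 - c0) * y0)"
    by (intro pdvd_add pdvd_diff eq1 c g pdvd_mult_right Y)
  hence "pdvd 1 (c1 * (y1 - y0))" by (simp add: algebra_simps)
  hence d0: "pdvd 1 (y1 - y0)" by (rule pdvd_unit_cancel[OF u])
  \<comment> \<open>Weighting the change of \<open>c\<close> by \<open>y2\<close> leaves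
    \<open>c1\<close> as the factor of \<open>y2 - y1\<close>, so the same unit is
    cancelled.\<close>
  have "pdvd 1 ((c2 * y2 - g2) - (c1 * y1 - g1) + (g2 - g1) - (c2 - c1) * y2)"
    by (intro pdvd_add pdvd_diff eq1 c g pdvd_mult_right Y)
  hence "pdvd 1 (c1 * (y2 - y1))" by (simp add: algebra_simps)
  thus d2: "pdvd 1 (y2 - y1)" by (rule pdvd_unit_cancel[OF u])
  have "pdvd 2 ((c1 - c0) * (y1 - y0))" "pdvd 2 ((c2 - c1) * (y2 - y1))"
    using pdvd_mult[OF c(1) d0] pdvd_mult[OF c(2) d2] by (simp_all add: numeral_2_eq_2)
  moreover have "pdvd 2 ((c0 * y0 - g0) + (c2 * y2 - g2) + (g0 - 2 * g1 + g2)
      - 2 * (c1 * y1 - g1) - (c0 - 2 * c1 + c2) * y1)"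
    by (intro pdvd_add pdvd_diff eq c g pdvd_mult_right pdvd_mult_left integral_numeral Y)
  ultimately have "pdvd 2 (((c0 * y0 - g0) + (c2 * y2 - g2) + (g0 - 2 * g1 + g2)
      - 2 * (c1 * y1 - g1) - (c0 - 2 * c1 + c2) * y1) - (c1 - c0) * (y1 - y0) - (c2 - c1) * (y2 - y1))"
    using pdvd_diff by blast
  hence "pdvd 2 (c1 * (y0 - 2 * y1 + y2))" by (simp add: algebra_simps)
  thus "pdvd 2 (y0 - 2 * y1 + y2)" by (rule pdvd_unit_cancel[OF u])
qed

text \<open>Modulo \<open>p\<close> the exponent is \<open>-(t + 2)\<close>, of absolute value at
  most 4.\<close>

lemma unit_e_t: "t \<le> 2 \<Longrightarrow> unit (of_int (e_t t))"
proof -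
  assume "t \<le> 2"
  have "unit (- of_nat (t + 2))" using p_ge_7 \<open>t \<le> 2\<close> by (intro unit_minus unit_less) auto
  moreover have "of_int (e_t t) - - of_nat (t + 2) = (of_nat p * of_nat t :: rat)"
    by (simp add: e_t_def algebra_simps)
  moreover have "pdvd 1 (of_nat p * of_nat t)" by (intro pdvd_mult_right pdvd_p integral_of_nat)
  ultimately show ?thesis using unit_cong by metis
qed

text \<open>By \<open>Y_G_cong\<close>, \<open>Y\<close> solves a linear equation with coefficient
  \<open>2 powi e - 1\<close> and right-hand side \<open>G e\<close>; both have the required
  differences by Fermat.\<close>

lemma Y_differences:
  shows "pdvd 1 (Y 2 - Y 1)" "pdvd 2 (Y 0 - 2 * Y 1 + Y 2)"
proof -
  let ?q = "int p - 1"
  have e: "e_t 0 = -2" "e_t 1 = -2 + ?q" "e_t 2 = -2 + 2 * ?q" by (simp_all add: e_t_def)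
  have first: "pdvd 1 (of_nat k powi (e + ?q) - of_nat k powi e)" if "\<not> p dvd k" for k e
    using power_int_shift_cong[OF that, of e 1] by simp
  have eq: "- 2 + 2 * ?q = (-2 + ?q) + ?q" by simp
  have shift: "a + b - 1 = (a - 1) + b" for a b :: int by simp
  have "\<not> p dvd 2" using p_ge_7 nat_dvd_not_less[of 2 p] by simp
  note two = first[OF this] power_int_second_difference[OF this]
  have c: "pdvd 1 ((2 powi e_t 1 - 1) - (2 powi e_t 0 - 1))" "pdvd 1 ((2 powi e_t 2 - 1) - (2 powi e_t 1 - 1))"
    "pdvd 2 ((2 powi e_t 0 - 1) - 2 * (2 powi e_t 1 - 1) + (2 powi e_t 2 - 1))"
    using two(1)[of "-2"] two(1)[of "-2 + ?q"] two(2)[of "-2"] unfolding e by (simp_all add: algebra_simps)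
  have g1: "pdvd 1 (G (e + ?q) - G e)" for e
    unfolding G_def sum_subtractf[symmetric] shift by (intro pdvd_sum first not_dvd_double)
  have g2: "pdvd 2 (G e - 2 * G (e + ?q) + G (e + 2 * ?q))" for e
    unfolding G_def sum_distrib_left sum_subtractf[symmetric] sum.distrib[symmetric] shift
    by (intro pdvd_sum power_int_second_difference not_dvd_double)
  have g: "pdvd 1 (G (e_t 1) - G (e_t 0))" "pdvd 1 (G (e_t 2) - G (e_t 1))"
    "pdvd 2 (G (e_t 0) - 2 * G (e_t 1) + G (e_t 2))"
    using g1[of "-2"] g1[of "-2 + ?q"] g2[of "-2"] unfolding e by (simp_all add: eq)
  have u: "unit (2 powi e_t 1 - 1)" unfolding e_t_def by (rule unit_two_powi_minus_1)
  have y: "integral (Y 0)" "integral (Y 1)" "integral (Y 2)"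
    by (intro integral_Y unit_e_t; simp)+
  have yg: "pdvd 2 ((2 powi e_t 0 - 1) * Y 0 - G (e_t 0))" "pdvd 2 ((2 powi e_t 1 - 1) * Y 1 - G (e_t 1))"
    "pdvd 2 ((2 powi e_t 2 - 1) * Y 2 - G (e_t 2))"
    by (intro Y_G_cong unit_e_t; simp)+
  show "pdvd 1 (Y 2 - Y 1)" "pdvd 2 (Y 0 - 2 * Y 1 + Y 2)"
    using second_difference_cancel[OF u y yg c g] by blast+
qed

end

section \<open>Power sums and Bernoulli numbers\<close>

lemma bernoulli_recurrence:
  "(\<Sum>j\<le>n. of_nat ((n + 1) choose j) * bernoulli j) = (if n = 0 then 1 else 0)"
proof (cases "n = 0")
  case False
  have "{..n} = insert n {..<n}" by auto
  moreover have "of_nat (n + 1) * bernoulli n = - (\<Sum>j<n. of_nat ((n + 1) choose j) * bernoulli j)"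
    using False by (subst bernoulli.simps) (simp add: field_simps del: binomial_Suc_Suc)
  ultimately show ?thesis using False by simp
qed (simp add: bernoulli.simps)

text \<open>Both sides count ordered pairs of disjoint subsets of sizes \<open>j\<close> and
  \<open>i\<close>, a multinomial coefficient.\<close>

lemma binomial_exchange:
  assumes "i + j \<le> n"
  shows "(n choose j) * ((n - j) choose i) = (n choose i) * ((n - i) choose j)"
proof -
  have "(n choose (i + j)) * ((i + j) choose i) = (n choose i) * ((n - i) choose j)"
    using choose_mult[of i "i + j" n] assms by simp
  moreover have "(n choose (i + j)) * ((i + j) choose j) = (n choose j) * ((n - j) choose i)"
    using choose_mult[of j "i + j" n] assms by simp
  moreover have "(i + j) choose i = (i + j) choose j"
    using binomial_symmetric[of i "i + j"] by simp
  ultimately show ?thesis by simp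
qed

lemma power_Suc_diff: "(x + 1) ^ n - x ^ n = (\<Sum>i<n. of_nat (n choose i) * x ^ i)"
  for x :: rat
proof -
  have "{..n} = insert n {..<n}" by auto
  thus ?thesis by (simp add: binomial_ring[of x 1])
qed

text \<open>Telescoping a polynomial whose forward difference is \<open>(m + 1) * x ^ m\<close>. The
  coefficients are arranged so that each term contains \<open>n ^ s / s\<close>, the quantity to be
  estimated p-adically.\<close>

lemma faulhaber:
  "(\<Sum>k<n. of_nat k ^ m)
     = (\<Sum>j\<le>m. of_nat (m choose j) * (bernoulli j * (of_nat n ^ (m + 1 - j) / of_nat (m + 1 - j))))"
proof -
  have coeff: "of_nat (m choose j) / of_nat (m + 1 - j) = (of_nat ((m + 1) choose j) / of_nat (m + 1) :: rat)"
    if "j \<le> m" for j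
  proof -
    have "(m + 1 - j) * ((m + 1) choose j) = (m + 1) * (m choose j)"
      using binomial_absorb_comp[of "m + 1" j] by simp
    hence "of_nat (m + 1 - j) * of_nat ((m + 1) choose j) = (of_nat (m + 1) * of_nat (m choose j) :: rat)"
      unfolding of_nat_mult[symmetric] by simp
    thus ?thesis using that by (simp add: field_simps del: binomial_Suc_Suc of_nat_diff of_nat_Suc)
  qed
  \<comment> \<open>This is the Bernoulli polynomial of degree \<open>m + 1\<close> minus its
    constant term.\<close>
  define Q where "Q x = (\<Sum>j\<le>m. of_nat ((m + 1) choose j) * bernoulli j * x ^ (m + 1 - j))" for x :: rat
  have step: "Q (x + 1) - Q x = of_nat (m + 1) * x ^ m" for x
  proof -
    let ?c = "\<lambda>i j. of_nat ((m + 1) choose j) * bernoulli j * (of_nat ((m + 1 - j) choose i) * x ^ i) :: rat"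
    have "Q (x + 1) - Q x = (\<Sum>j\<le>m. of_nat ((m + 1) choose j) * bernoulli j
        * ((x + 1) ^ (m + 1 - j) - x ^ (m + 1 - j)))"
      by (simp only: Q_def right_diff_distrib sum_subtractf)
    also have "\<dots> = (\<Sum>j\<le>m. \<Sum>i<m+1-j. ?c i j)"
      by (simp only: power_Suc_diff sum_distrib_left)
    \<comment> \<open>Summing over the triangle by powers of \<open>x\<close> first turns each inner
      sum into a Bernoulli recurrence, which vanishes unless \<open>i = m\<close>.\<close>
    also have "\<dots> = (\<Sum>i\<le>m. \<Sum>j\<le>m-i. ?c i j)"
      unfolding sum.Sigma[OF finite_atMost ballI[OF finite_lessThan]]
        sum.Sigma[OF finite_atMost ballI[OF finite_atMost]]
      by (rule sum.reindex_bij_witness[of _ "\<lambda>(a, b). (b, a)" "\<lambda>(a, b). (b, a)"]) auto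
    also have "\<dots> = (\<Sum>i\<le>m. of_nat ((m + 1) choose i) * x ^ i
        * (\<Sum>j\<le>m-i. of_nat ((m - i + 1) choose j) * bernoulli j))"
    proof (intro sum.cong refl, unfold sum_distrib_left, intro sum.cong refl)
      fix i j assume ij: "i \<in> {..m}" "j \<in> {..m - i}"
      hence "((m + 1) choose j) * ((m + 1 - j) choose i) = ((m + 1) choose i) * ((m - i + 1) choose j)"
        using binomial_exchange[of i j "m + 1"] by (auto simp: Suc_diff_le)
      hence "of_nat ((m + 1) choose j) * of_nat ((m + 1 - j) choose i)
          = (of_nat ((m + 1) choose i) * of_nat ((m - i + 1) choose j) :: rat)"
        unfolding of_nat_mult[symmetric] by simp
      moreover have "a * b = c * d \<Longrightarrow> a * y * (b * z) = c * z * (d * y)" for a b c d y z :: rat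
        by (metis mult.assoc mult.commute mult.left_commute)
      ultimately show "?c i j = of_nat ((m + 1) choose i) * x ^ i * (of_nat ((m - i + 1) choose j) * bernoulli j)"
        by blast
    qed
    also have "\<dots> = (\<Sum>i\<le>m. if i = m then of_nat ((m + 1) choose i) * x ^ i else 0)"
      unfolding bernoulli_recurrence by (intro sum.cong refl) auto
    also have "\<dots> = of_nat (m + 1) * x ^ m" by simp
    finally show ?thesis .
  qed
  have "of_nat (m + 1) * (\<Sum>k<n. of_nat k ^ m) = Q (of_nat n)"
  proof (induction n)
    case 0
    show ?case by (simp add: Q_def power_0_left)
  next
    case (Suc n)
    thus ?case using step[of "of_nat n"] by (simp add: algebra_simps)
  qed
  hence "(\<Sum>k<n. of_nat k ^ m) = Q (of_nat n) / of_nat (m + 1)"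
    by (simp add: field_simps del: of_nat_Suc)
  also have "\<dots> = (\<Sum>j\<le>m. (of_nat ((m + 1) choose j) / of_nat (m + 1)) * (bernoulli j * of_nat n ^ (m + 1 - j)))"
    by (simp add: Q_def sum_divide_distrib mult.assoc del: binomial_Suc_Suc of_nat_Suc)
  also have "\<dots> = (\<Sum>j\<le>m. of_nat (m choose j) * (bernoulli j * (of_nat n ^ (m + 1 - j) / of_nat (m + 1 - j))))"
    by (intro sum.cong refl) (simp only: coeff[symmetric] atMost_iff, simp)
  finally show ?thesis .
qed

section \<open>p-adic estimates in Faulhaber's formula\<close>

context p_ge_7
begin

text \<open>For \<open>s \<le> 4\<close> the denominator is a unit; for larger \<open>s\<close> the
  valuation \<open>v\<close> of \<open>s\<close> satisfies \<open>v + 4 \<le> s\<close>, so at least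
  four powers of \<open>p\<close> survive.\<close>

lemma p_power_div_pdvd:
  assumes "r \<le> 4" "r \<le> s" "s > 0"
  shows "pdvd r (of_nat p ^ s / of_nat s)"
proof (cases "s \<le> 4")
  case True
  hence "unit (of_nat s)" using assms p_ge_7 by (intro unit_less) auto
  hence "pdvd r (of_nat p ^ s * inverse (of_nat s))"
    by (intro pdvd_mult_right unit_integral[OF unit_inverse] pdvd_mono[OF pdvd_p_power assms(2)])
  thus ?thesis by (simp add: divide_inverse)
next
  case False
  obtain u where u: "s = p ^ multiplicity p s * u" "\<not> p dvd u"
    using multiplicity_decompose'[of s p] assms(3) prime_p not_prime_unit
    by (metis neq0_conv)
  define v where "v = multiplicity p s"
  \<comment> \<open>For positive \<open>v\<close> this follows from
    \<open>s \<ge> p ^ v \<ge> 7 ^ v\<close>; for \<open>v = 0\<close> it is the case assumption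
    \<open>s > 4\<close>.\<close>
  have "v + 4 \<le> s"
  proof (cases v)
    case (Suc w)
    have "w + 5 \<le> 7 * 7 ^ w" by (induction w) auto
    hence "v + 4 \<le> 7 ^ v" using Suc by simp
    also have "(7::nat) ^ v \<le> p ^ v" using p_ge_7 by (rule power_mono) simp
    also have "\<dots> \<le> s" using u assms(3) unfolding v_def
      by (metis dvd_imp_le dvd_triv_left)
    finally show ?thesis .
  qed (use False in simp)
  hence "of_nat p ^ s = (of_nat p ^ (s - v) * of_nat p ^ v :: rat)"
    by (simp flip: power_add)
  moreover have "of_nat s = (of_nat p ^ v * of_nat u :: rat)"
    using arg_cong[OF u(1), of "of_nat :: nat \<Rightarrow> rat"] by (simp add: v_def)
  ultimately have "of_nat p ^ s / of_nat s = (of_nat p ^ (s - v) * inverse (of_nat u) :: rat)"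
    by (simp add: divide_inverse)
  moreover have "pdvd r (of_nat p ^ (s - v) * inverse (of_nat u))"
    using \<open>v + 4 \<le> s\<close> assms(1)
    by (intro pdvd_mult_right unit_integral[OF unit_inverse] unit_of_nat u(2)
        pdvd_mono[OF pdvd_p_power]) simp
  ultimately show ?thesis by simp
qed

text \<open>One power of \<open>p\<close> pays for the possible denominator \<open>p\<close> of
  \<open>b\<close>, which explains \<open>Suc r\<close>.\<close>

lemma faulhaber_term_pdvd:
  assumes "integral (of_nat p * b)" "r \<le> 3" "Suc r \<le> s"
  shows "pdvd r (of_nat c * (b * (of_nat p ^ s / of_nat s)))"
proof -
  have "pdvd (Suc r) (of_nat p * b * (of_nat p ^ s / of_nat s))"
    using assms by (intro pdvd_mult_left p_power_div_pdvd) auto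
  hence "pdvd r (b * (of_nat p ^ s / of_nat s))" by (simp only: mult.assoc pdvd_mult_p_iff)
  thus ?thesis by (rule pdvd_mult_left[OF integral_of_nat])
qed

definition R :: "nat \<Rightarrow> rat" where "R m = (\<Sum>k<p. of_nat k ^ m)"

lemma R_eq_S: "m > 0 \<Longrightarrow> R m = S (int m)"
proof -
  assume "m > 0"
  moreover have "{..<p} = insert 0 {1..p-1}" using p_ge_7 by auto
  ultimately show ?thesis by (simp add: R_def S_def)
qed

lemma R_minus_bernoulli: "R m - of_nat p * bernoulli m
    = (\<Sum>j<m. of_nat (m choose j) * (bernoulli j * (of_nat p ^ (m + 1 - j) / of_nat (m + 1 - j))))"
proof -
  have "{..m} = insert m {..<m}" by auto
  thus ?thesis by (simp add: R_def faulhaber[of m p] mult.commute)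
qed

text \<open>A weak form of the von Staudt-Clausen theorem: \<open>p * bernoulli m\<close> is an
  integer power sum minus terms that are integral by induction.\<close>

lemma integral_p_bernoulli: "integral (of_nat p * bernoulli m)"
proof (induction m rule: less_induct)
  case (less m)
  have "pdvd 0 (R m - of_nat p * bernoulli m)" unfolding R_minus_bernoulli
    by (intro pdvd_sum faulhaber_term_pdvd less.IH) auto
  moreover have "pdvd 0 (R m)" unfolding R_def by (intro pdvd_sum) (simp add: integral_power)
  ultimately have "pdvd 0 (R m - (R m - of_nat p * bernoulli m))" by (rule pdvd_diff[rotated])
  thus ?case by simp
qed

lemma R_bernoulli_cong_1: "pdvd 1 (R m - of_nat p * bernoulli m)"
  unfolding R_minus_bernoulli by (intro pdvd_sum faulhaber_term_pdvd integral_p_bernoulli) auto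

lemma integral_bernoulli:
  assumes "pdvd 1 (R m)"
  shows "integral (bernoulli m)"
proof -
  have "pdvd (Suc 0) (of_nat p * bernoulli m)"
    using pdvd_diff[OF assms R_bernoulli_cong_1[of m]] by simp
  thus ?thesis unfolding pdvd_mult_p_iff by simp
qed

text \<open>Terms with \<open>p ^ s\<close>, \<open>s \<ge> 3\<close>, are harmless; the one with
  \<open>s = 2\<close> needs its Bernoulli factor to be integral.\<close>

lemma R_bernoulli_cong_2:
  assumes "integral (bernoulli m)"
  shows "pdvd 2 (R (Suc m) - of_nat p * bernoulli (Suc m))"
proof -
  have "pdvd 2 (of_nat (Suc m choose m) * (bernoulli m * (of_nat p ^ 2 / of_nat 2)))"
    by (intro pdvd_mult_left integral_of_nat assms p_power_div_pdvd) auto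
  moreover have "pdvd 2 (\<Sum>j<m. of_nat (Suc m choose j)
      * (bernoulli j * (of_nat p ^ (Suc m + 1 - j) / of_nat (Suc m + 1 - j))))"
    by (intro pdvd_sum faulhaber_term_pdvd integral_p_bernoulli) auto
  moreover have "Suc m + 1 - m = 2" by simp
  ultimately show ?thesis
    unfolding R_minus_bernoulli sum.lessThan_Suc by (intro pdvd_add) simp_all
qed

text \<open>The critical terms are \<open>s = 3\<close>, covered by integrality, and
  \<open>s = 2\<close>, which takes its third factor \<open>p\<close> from the Bernoulli
  number.\<close>

lemma R_bernoulli_cong_3:
  assumes "pdvd 1 (bernoulli (Suc m))" "integral (bernoulli m)"
  shows "pdvd 3 (R (Suc (Suc m)) - of_nat p * bernoulli (Suc (Suc m)))"
proof -
  let ?f = "\<lambda>j. of_nat (Suc (Suc m) choose j)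
      * (bernoulli j * (of_nat p ^ (Suc (Suc m) + 1 - j) / of_nat (Suc (Suc m) + 1 - j)))"
  have *: "Suc (Suc m) + 1 - m = 3" "Suc (Suc m) + 1 - Suc m = 2" by simp_all
  have "pdvd 3 (?f m)" unfolding *
    by (intro pdvd_mult_left integral_of_nat assms p_power_div_pdvd) auto
  moreover have "pdvd (1 + 2) (bernoulli (Suc m) * (of_nat p ^ 2 / of_nat 2))"
    by (intro pdvd_mult assms p_power_div_pdvd) auto
  hence "pdvd 3 (?f (Suc m))" unfolding *
    by (intro pdvd_mult_left[OF integral_of_nat]) (simp add: numeral_3_eq_3)
  moreover have "pdvd 3 (\<Sum>j<m. ?f j)"
    by (intro pdvd_sum faulhaber_term_pdvd integral_p_bernoulli) auto
  ultimately show ?thesis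
    unfolding R_minus_bernoulli sum.lessThan_Suc by (intro pdvd_add)
qed

text \<open>The conditions on the Bernoulli numbers of index \<open>m - 2\<close> and
  \<open>m - 1\<close> are read off the power sums with those exponents, using
  \<open>S_pdvd\<close>.\<close>

lemma S_bernoulli_cong:
  assumes "int m = e_t t" "m \<ge> 3"
  shows "pdvd 3 (S (e_t t) - of_nat p * bernoulli m)"
proof -
  define n where "n = m - 2"
  have n: "m = Suc (Suc n)" "n > 0" using assms(2) by (simp_all add: n_def)
  have e: "int n = -4 + int t * (int p - 1)" "int (Suc n) = -3 + int t * (int p - 1)"
    using assms(1) n by (simp_all add: e_t_def)
  have R: "R m = S (e_t t)" using R_eq_S[of m] assms by simp
  have "pdvd 1 (R n)" using R_eq_S[OF n(2)] S_pdvd(2)[of t] unfolding e by simp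
  hence i: "integral (bernoulli n)" by (rule integral_bernoulli)
  have "pdvd 2 (R (Suc n))" using R_eq_S[of "Suc n"] S_pdvd(3)[of t] unfolding e by simp
  from pdvd_diff[OF this R_bernoulli_cong_2[OF i]]
  have "pdvd (Suc 1) (of_nat p * bernoulli (Suc n))" by (simp add: numeral_2_eq_2)
  hence "pdvd 1 (bernoulli (Suc n))" by (simp only: pdvd_mult_p_iff)
  from R_bernoulli_cong_3[OF this i] show "pdvd 3 (S (e_t t) - of_nat p * bernoulli m)"
    unfolding R[symmetric] n .
qed

text \<open>Linear extrapolation: \<open>Y 0\<close> is congruent to \<open>2 * Y 1 - Y 2\<close>
  modulo \<open>p^2\<close>, and \<open>Y 1\<close>, \<open>Y 2\<close> are expressed by Bernoulli
  numbers.\<close>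

lemma S_minus_2_cong:
  "pdvd 3 (S (-2) - (of_nat p * (4/3 * bernoulli (p - 3) - 1/2 * bernoulli (2 * p - 4))
     + 1/9 * of_nat p ^ 2 * bernoulli (p - 3)))"
proof -
  define P :: rat where "P = of_nat p"
  define B1 where "B1 = bernoulli (p - 3)"
  define B2 where "B2 = bernoulli (2 * p - 4)"
  define E1 where "E1 = S (e_t 1) - P * B1"
  define E2 where "E2 = S (e_t 2) - P * B2"
  have e: "e_t 0 = -2" "e_t 1 = int p - 3" "e_t 2 = 2 * int p - 4" by (simp_all add: e_t_def)
  have "int (p - 3) = e_t 1" "int (2 * p - 4) = e_t 2" using p_ge_7 unfolding e by auto
  hence E: "pdvd 3 E1" "pdvd 3 E2"
    unfolding E1_def E2_def P_def B1_def B2_def using p_ge_7 by (auto intro!: S_bernoulli_cong)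
  have P0: "P \<noteq> 0" "P - 3 \<noteq> 0" "2 * P - 4 \<noteq> 0"
    using p_ge_7 of_nat_eq_iff[of p 3, where ?'a = rat] of_nat_eq_iff[of p 2, where ?'a = rat]
    by (auto simp: P_def)
  have S: "S (-2) = -2 * P * Y 0" "S (e_t 1) = (P - 3) * P * Y 1" "S (e_t 2) = (2 * P - 4) * P * Y 2"
    using P0 unfolding Y_def e by (simp_all flip: P_def)
  have B: "P * B1 = (P - 3) * P * Y 1 - E1" "P * B2 = (2 * P - 4) * P * Y 2 - E2"
    unfolding E1_def E2_def S by simp_all
  have "S (-2) - (P * (4/3 * B1 - 1/2 * B2) + 1/9 * P ^ 2 * B1)
      = S (-2) - (4/3 * (P * B1) - 1/2 * (P * B2) + P / 9 * (P * B1))"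
    by (simp add: algebra_simps power2_eq_square)
  \<comment> \<open>The factors 4/3 and 1/2 match the terms linear in \<open>P\<close>. They leave
    \<open>P ^ 2\<close> times 4/3 of \<open>Y 1\<close> minus \<open>Y 2\<close>; the 1/9 term
    lowers 4/3 to 1, giving a first difference of \<open>Y\<close>.\<close>
  also have "\<dots> = - 2 * (P * (Y 0 - 2 * Y 1 + Y 2)) + P * (P * (Y 2 - Y 1)) - P ^ 3 * (Y 1 / (3 * 3))
      + (2 * 2 / 3 + P / (3 * 3)) * E1 - 1 / 2 * E2"
    unfolding S B by (simp add: field_simps power2_eq_square power3_eq_cube)
  also have "pdvd 3 \<dots>"
  proof (intro pdvd_add pdvd_diff)
    show "pdvd 3 (- 2 * (P * (Y 0 - 2 * Y 1 + Y 2)))"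
    proof (rule pdvd_mult_left)
      show "pdvd 3 (P * (Y 0 - 2 * Y 1 + Y 2))"
        using Y_differences(2) by (simp add: numeral_3_eq_3 numeral_2_eq_2 pdvd_mult_p_iff P_def)
    qed (intro integral_minus integral_numeral)
    show "pdvd 3 (P * (P * (Y 2 - Y 1)))"
      using Y_differences(1) by (simp add: numeral_3_eq_3 pdvd_mult_p_iff P_def)
    show "pdvd 3 (P ^ 3 * (Y 1 / (3 * 3)))"
      unfolding P_def using integral_Y unit_e_t[of 1]
      by (intro pdvd_mult_right integral_divide_unit unit_mult unit_3 pdvd_p_power) simp
    show "pdvd 3 ((2 * 2 / 3 + P / (3 * 3)) * E1)"
      unfolding P_def by (intro pdvd_mult_left E integral_add integral_divide_unit integral_mult
          integral_numeral integral_of_nat unit_mult unit_3)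
    show "pdvd 3 (1 / 2 * E2)"
      by (intro pdvd_mult_left E integral_divide_unit integral_1 unit_2)
  qed
  finally show ?thesis unfolding P_def B1_def B2_def .
qed

end

section \<open>Reduction to the power sum\<close>

text \<open>Passing from \<open>k\<close> to \<open>k + 1\<close> multiplies the left side by
  \<open>(N - K) * (N + K) / K ^ 2\<close> with \<open>N = n + 1\<close> and
  \<open>K = k + 1\<close>.\<close>

lemma binomial_product_eq:
  "of_nat ((n choose k) * ((n + k) choose k)) * of_nat (n + 1 + k)
     = (of_nat (n + 1) * ((-1) ^ k * (\<Prod>j=1..k. 1 - of_nat (n + 1) ^ 2 / of_nat j ^ 2)) :: rat)"
proof (induction k)
  case (Suc k)
  let ?N = "of_nat (n + 1) :: rat" and ?K = "of_nat (Suc k) :: rat"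
  show ?case
  proof (cases "k \<le> n")
    case True
    have "Suc k * (n choose Suc k) = (n - k) * (n choose k)"
      using binomial_absorption[of k n] binomial_absorb_comp[of n k] by simp
    hence "of_nat (Suc k) * of_nat (n choose Suc k) = (of_nat (n - k) * of_nat (n choose k) :: rat)"
      unfolding of_nat_mult[symmetric] by simp
    hence 1: "of_nat (n choose Suc k) = ((?N - ?K) * of_nat (n choose k) / ?K :: rat)"
      using True by (simp add: field_simps del: binomial_Suc_Suc)
    have "Suc k * (Suc (n + k) choose Suc k) = Suc (n + k) * ((n + k) choose k)"
      by (rule Suc_times_binomial)
    hence "of_nat (Suc k) * of_nat ((n + Suc k) choose Suc k)
        = (of_nat (n + 1 + k) * of_nat ((n + k) choose k) :: rat)"
      unfolding of_nat_mult[symmetric] by (simp del: binomial_Suc_Suc)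
    hence 2: "of_nat ((n + Suc k) choose Suc k) = (of_nat (n + 1 + k) * of_nat ((n + k) choose k) / ?K :: rat)"
      by (simp add: field_simps del: binomial_Suc_Suc of_nat_Suc)
    have K: "?K \<noteq> 0" by simp
    have "of_nat ((n choose Suc k) * ((n + Suc k) choose Suc k)) * of_nat (n + 1 + Suc k)
        = (?N - ?K) * (?N + ?K) / ?K ^ 2
          * (of_nat ((n choose k) * ((n + k) choose k)) * of_nat (n + 1 + k))"
      unfolding of_nat_mult 1 2 by (simp add: power2_eq_square del: of_nat_Suc)
    also have "(?N - ?K) * (?N + ?K) / ?K ^ 2 = - (1 - ?N ^ 2 / ?K ^ 2)"
      using K by (simp add: power2_eq_square diff_divide_distrib algebra_simps del: of_nat_Suc)
    finally show ?thesis unfolding Suc.IH by (simp add: algebra_simps del: of_nat_Suc binomial_Suc_Suc)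
  next
    case False
    \<comment> \<open>Beyond \<open>n\<close> both sides vanish: the product contains the factor at
      \<open>j = n + 1\<close>.\<close>
    have "(\<Prod>j=1..Suc k. 1 - ?N ^ 2 / of_nat j ^ 2) = 0"
      using False by (intro prod_zero bexI[of _ "n + 1"]) auto
    thus ?thesis using False by (simp add: binomial_eq_0 del: binomial_Suc_Suc)
  qed
qed simp

text \<open>Symmetrization: doubling the sum over pairs \<open>j \<le> k\<close> gives all ordered
  pairs, with the diagonal counted twice.\<close>

lemma sum_mult_partial_sums:
  "2 * (\<Sum>k=1..n. a k * (\<Sum>j=1..k. a j)) = (\<Sum>k=1..n. a k) ^ 2 + (\<Sum>k=1..n. a k ^ 2)"
  for a :: "nat \<Rightarrow> rat"
  by (induction n) (simp_all add: algebra_simps power2_eq_square)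

section \<open>Expansion of the summands in powers of \<open>p\<close>\<close>

context p_ge_7
begin

definition H :: "nat \<Rightarrow> rat" where "H k = (\<Sum>j=1..k. of_nat j powi -2)"

definition Q :: "nat \<Rightarrow> rat" where "Q k = (\<Prod>j=1..k. 1 - of_nat p ^ 2 / of_nat j ^ 2) ^ 2"

lemma powi_minus_2: "x powi -2 = 1 / x ^ 2" for x :: rat
  by (simp add: power_int_def power_inverse divide_inverse)

lemma apery_eq:
  "of_nat (\<Sum>k=0..p-1. ((p-1) choose k)^2 * ((p-1+k) choose k)^2)
     = 1 + of_nat p ^ 2 * (\<Sum>k=1..p-1. (of_nat k + of_nat p) powi -2 * Q k)"
proof -
  have "of_nat (((p-1) choose k)^2 * ((p-1+k) choose k)^2)
      = of_nat p ^ 2 * ((of_nat k + of_nat p) powi -2 * Q k)" for k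
  proof -
    have "p - 1 + 1 = p" using p_ge_7 by simp
    hence "of_nat (((p-1) choose k) * ((p-1+k) choose k)) * of_nat (p + k)
      = (of_nat p * ((-1) ^ k * (\<Prod>j=1..k. 1 - of_nat p ^ 2 / of_nat j ^ 2)) :: rat)"
      using binomial_product_eq[of "p - 1" k] by simp
    hence "(of_nat (((p-1) choose k) * ((p-1+k) choose k)) * of_nat (p + k)) ^ 2
      = (of_nat p * ((-1) ^ k * (\<Prod>j=1..k. 1 - of_nat p ^ 2 / of_nat j ^ 2)) :: rat) ^ 2" by (rule arg_cong)
    hence "of_nat (((p-1) choose k)^2 * ((p-1+k) choose k)^2) * of_nat (p + k) ^ 2 = of_nat p ^ 2 * Q k"
      by (simp add: Q_def power_mult_distrib flip: power_mult mult.assoc)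
    moreover have "(of_nat (p + k) :: rat) \<noteq> 0" unfolding of_nat_eq_0_iff by simp
    ultimately show ?thesis unfolding powi_minus_2 by (simp add: field_simps add.commute)
  qed
  moreover have "{0..p-1} = insert 0 {1..p-1}" by auto
  ultimately show ?thesis by (simp add: sum_distrib_left)
qed

lemma integral_H: "k < p \<Longrightarrow> integral (H k)"
  unfolding H_def pdvd_0_iff[symmetric]
  by (intro pdvd_sum) (auto intro!: unit_integral unit_power_int unit_less)

text \<open>To first order in \<open>p^2\<close> the product is \<open>1 - p^2 * H k\<close>, and
  squaring doubles the correction; what is dropped carries \<open>p^4\<close>.\<close>

lemma Q_cong: "k < p \<Longrightarrow> pdvd 3 (Q k - 1 + 2 * of_nat p ^ 2 * H k)"
proof (induction k)
  case 0
  show ?case by (simp add: Q_def H_def)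
next
  case (Suc k)
  define a :: rat where "a = of_nat (Suc k) powi -2"
  define P :: rat where "P = of_nat p"
  have a: "integral a" unfolding a_def
    using Suc.prems by (intro unit_integral unit_power_int unit_less) auto
  have P: "integral P" by (simp add: P_def)
  have Hk: "integral (H k)" using Suc.prems by (intro integral_H) simp
  have "Q (Suc k) = (1 - P ^ 2 * a) ^ 2 * Q k"
    by (simp add: Q_def a_def P_def powi_minus_2 power_mult_distrib mult.commute)
  moreover have "H (Suc k) = H k + a" by (simp add: H_def a_def)
  ultimately have "Q (Suc k) - 1 + 2 * P ^ 2 * H (Suc k)
      = (1 - P ^ 2 * a) ^ 2 * (Q k - 1 + 2 * P ^ 2 * H k)
        + P ^ 3 * (P * (a ^ 2 * (1 - 2 * P ^ 2 * H k) + 4 * a * H k))"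
    by (simp add: algebra_simps power2_eq_square power3_eq_cube)
  also have "pdvd 3 \<dots>"
  proof (intro pdvd_add)
    show "pdvd 3 ((1 - P ^ 2 * a) ^ 2 * (Q k - 1 + 2 * P ^ 2 * H k))"
      using Suc.IH Suc.prems unfolding P_def[symmetric]
      by (intro pdvd_mult_left integral_power integral_diff integral_mult integral_1 a P) auto
    have "pdvd 3 (P ^ 3)" by (simp add: P_def)
    thus "pdvd 3 (P ^ 3 * (P * (a ^ 2 * (1 - 2 * P ^ 2 * H k) + 4 * a * H k)))"
      by (rule pdvd_mult_right) (intro integral_add integral_power integral_diff integral_mult
          integral_1 integral_numeral a P Hk)
  qed
  finally show ?case unfolding P_def .
qed

text \<open>The coefficients -2 and 3 are those of the binomial series with exponent -2. In the term
  with \<open>p^2 * H k\<close>, replacing \<open>k + p\<close> by \<open>k\<close> costs only a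
  multiple of \<open>p^3\<close>.\<close>

lemma apery_summand_cong:
  assumes "0 < k" "k < p"
  shows "pdvd 3 ((of_nat k + of_nat p) powi -2 * Q k
    - (of_nat k powi -2 - 2 * of_nat p * of_nat k powi -3 + 3 * of_nat p ^ 2 * of_nat k powi -4
       - 2 * of_nat p ^ 2 * (of_nat k powi -2 * H k)))"
proof -
  have k: "unit (of_nat k)" using unit_less assms by blast
  define P :: rat where "P = of_nat p"
  define K :: rat where "K = of_nat k"
  define b where "b = (K + P) powi -2"
  have unit: "unit (K + P)" using unit_cong[OF k, of "K + P"] by (simp add: K_def P_def)
  have 1: "pdvd 3 (b - (K powi -2 - 2 * P * K powi -3 + 3 * P ^ 2 * K powi -4))"
    using expand[OF k pdvd_p, of "-2"] by (simp add: b_def K_def P_def)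
  have 2: "pdvd 1 (b - K powi -2)"
    using expand1[OF k pdvd_p, of "-2"] by (simp add: b_def K_def P_def)
  have "pdvd (2 + 1) (P ^ 2 * (b - K powi -2))" unfolding P_def by (intro pdvd_mult pdvd_p_power 2[unfolded P_def])
  hence 3: "pdvd 3 (2 * H k * (P ^ 2 * (b - K powi -2)))"
    using pdvd_mult_left[OF integral_mult[OF integral_numeral integral_H[OF assms(2)]]] by simp
  have 4: "pdvd 3 (b * (Q k - 1 + 2 * P ^ 2 * H k))"
    using Q_cong[OF assms(2)] unit unfolding P_def b_def
    by (intro pdvd_mult_left unit_integral unit_power_int)
  have "b * Q k - (K powi -2 - 2 * P * K powi -3 + 3 * P ^ 2 * K powi -4 - 2 * P ^ 2 * (K powi -2 * H k))
     = b * (Q k - 1 + 2 * P ^ 2 * H k) - 2 * H k * (P ^ 2 * (b - K powi -2))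
       + (b - (K powi -2 - 2 * P * K powi -3 + 3 * P ^ 2 * K powi -4))"
    by (simp only: algebra_simps)
  also have "pdvd 3 \<dots>" by (intro pdvd_add pdvd_diff 1 3 4)
  finally show ?thesis unfolding b_def K_def P_def .
qed

text \<open>After summation every correction to \<open>S (-2)\<close> is divisible by
  \<open>p^3\<close>, and the prefactor \<open>p^2\<close> from \<open>apery_eq\<close> raises the
  precision to \<open>p^5\<close>.\<close>

lemma apery_cong:
  "pdvd 5 (of_nat (\<Sum>k=0..p-1. ((p-1) choose k)^2 * ((p-1+k) choose k)^2)
     - (1 + of_nat p ^ 2 * S (-2)))"
proof -
  define P :: rat where "P = of_nat p"
  define A where "A = (\<Sum>k=1..p-1. (of_nat k + of_nat p) powi -2 * Q k)"
  define M where "M = (\<Sum>k=1..p-1. of_nat k powi -2 * H k)"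
  have S: "pdvd 1 (S (-2))" "pdvd 1 (S (-4))" "pdvd 2 (S (-3))"
    using S_pdvd[of 0] by simp_all
  have "of_nat k powi -4 = (of_nat k powi -2 :: rat) ^ 2" for k
    by (simp add: power_int_power')
  \<comment> \<open>The double sum \<open>M\<close> reduces to single power sums by symmetrization,
    hence is divisible by \<open>p\<close>.\<close>
  hence "2 * M = S (-2) * S (-2) + S (-4)"
    unfolding M_def H_def S_def sum_mult_partial_sums by (simp add: power2_eq_square)
  moreover have "pdvd 1 (S (-2) * S (-2) + S (-4))"
    by (intro pdvd_add pdvd_mult_right S pdvd_integral[OF S(1)])
  ultimately have M: "pdvd 1 M" using pdvd_unit_cancel[OF unit_2] by metis
  have "A - (S (-2) - 2 * P * S (-3) + 3 * P ^ 2 * S (-4) - 2 * P ^ 2 * M)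
      = (\<Sum>k=1..p-1. (of_nat k + of_nat p) powi -2 * Q k
          - (of_nat k powi -2 - 2 * of_nat p * of_nat k powi -3 + 3 * of_nat p ^ 2 * of_nat k powi -4
             - 2 * of_nat p ^ 2 * (of_nat k powi -2 * H k)))"
    by (simp only: A_def S_def M_def P_def sum_distrib_left sum_subtractf sum.distrib)
  also have "pdvd 3 \<dots>" by (intro pdvd_sum apery_summand_cong) auto
  finally have 1: "pdvd 3 (A - (S (-2) - 2 * P * S (-3) + 3 * P ^ 2 * S (-4) - 2 * P ^ 2 * M))" .
  have "pdvd (1 + 2) (P * S (-3))" "pdvd (2 + 1) (P ^ 2 * S (-4))" "pdvd (2 + 1) (P ^ 2 * M)"
    unfolding P_def by (intro pdvd_mult S M pdvd_p pdvd_p_power)+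
  hence 2: "pdvd 3 (P * S (-3))" "pdvd 3 (P ^ 2 * S (-4))" "pdvd 3 (P ^ 2 * M)"
    by (simp_all add: numeral_3_eq_3)
  have "pdvd 3 ((A - (S (-2) - 2 * P * S (-3) + 3 * P ^ 2 * S (-4) - 2 * P ^ 2 * M))
      - 2 * (P * S (-3)) + 3 * (P ^ 2 * S (-4)) - 2 * (P ^ 2 * M))"
    by (intro pdvd_add pdvd_diff 1 pdvd_mult_left 2 integral_numeral)
  hence "pdvd 3 (A - S (-2))" by (simp add: algebra_simps)
  from pdvd_mult[OF pdvd_p_power[of 2] this] have "pdvd 5 (of_nat p ^ 2 * (A - S (-2)))" by simp
  moreover have "1 + of_nat p ^ 2 * A - (1 + of_nat p ^ 2 * S (-2)) = of_nat p ^ 2 * (A - S (-2))"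
    by (simp add: algebra_simps)
  ultimately show ?thesis unfolding apery_eq A_def[symmetric] by simp
qed

end

theorem theorem1p1:
  fixes p :: nat
  assumes "prime p" and "p \<ge> 7"
  shows "rat_cong_pow
           (of_nat (\<Sum>k=0..p-1. ((p-1) choose k)^2 * ((p-1+k) choose k)^2))
           (1 + of_nat p ^ 3 * (4/3 * bernoulli (p-3) - 1/2 * bernoulli (2*p-4))
              + 1/9 * of_nat p ^ 4 * bernoulli (p-3))
           p 5"
proof -
  interpret p_ge_7 p using assms by unfold_locales
  define A :: rat where "A = of_nat (\<Sum>k=0..p-1. ((p-1) choose k)^2 * ((p-1+k) choose k)^2)"
  define P :: rat where "P = of_nat p"
  define b where "b = 4/3 * bernoulli (p-3) - 1/2 * bernoulli (2*p-4)"
  \<comment> \<open>Multiplying the congruence for \<open>S (-2)\<close> modulo \<open>p^3\<close>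
    by \<open>p^2\<close> matches the precision of \<open>apery_cong\<close>.\<close>
  have "pdvd (2 + 3) (P ^ 2 * (S (-2) - (P * b + 1/9 * P ^ 2 * bernoulli (p-3))))"
    unfolding P_def b_def by (intro pdvd_mult pdvd_p_power S_minus_2_cong)
  hence "pdvd 5 ((A - (1 + P ^ 2 * S (-2))) + P ^ 2 * (S (-2) - (P * b + 1/9 * P ^ 2 * bernoulli (p-3))))"
    using apery_cong unfolding A_def P_def by (intro pdvd_add) simp_all
  also have "(A - (1 + P ^ 2 * S (-2))) + P ^ 2 * (S (-2) - (P * b + 1/9 * P ^ 2 * bernoulli (p-3)))
      = A - (1 + P ^ 3 * b + 1/9 * P ^ 4 * bernoulli (p-3))"
    by (simp add: algebra_simps power2_eq_square power3_eq_cube power4_eq_xxxx)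
  finally show ?thesis unfolding rat_cong_pow_iff A_def P_def b_def .
qed

end
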